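(* Let $t$ be a positive integer and let $G$ be a (finite, simple) graph. If $\alpha(G)\leq 2$ and $G$ has no strong odd $K_t$-immersion, then $\chi(G)\leq \left\lceil \tfrac{3}{2}(t-1)\right\rceil$.
   Context: All graphs are finite and simple (no loops or parallel edges). $\alpha(G)$ denotes the independence number of $G$ (the maximum size of a set of pairwise non-adjacent vertices) and $\chi(G)$ the chromatic number. A graph $G$ contains a graph $H$ as an immersion if there is an injective map $\varphi: V(H)\to V(G)$ and a set $\mathcal{P}$ of pairwise edge-disjoint paths in $G$ such that for every edge $uv\in E(H)$ there is a path $P_{uv}\in\mathcal{P}$ with endpoints $\varphi(u)$ and $\varphi(v)$. The vertices of $\varphi(V(H))$ are the terminals. The immersion is strong if no path in $\mathcal{P}$ contains a terminal as an interior vertex, and it is (totally) odd if every path in $\mathcal{P}$ has odd length (number of edges). A strong odd $K_t$-immersion is an immersion of the complete graph $K_t$ that is both strong and odd. *)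

theory Defs
  imports Complex_Main "HOL-Library.Ramsey"
begin

text \<open>A finite simple graph is a finite vertex set \<open>V\<close> together with a set \<open>E\<close> of two-element subsets
  of \<open>V\<close>; \<open>nsets\<close>, \<open>indep\<close> (independent vertex set) are the notions of the Ramsey library theory.\<close>

definition simple_graph :: "'a set \<Rightarrow> 'a set set \<Rightarrow> bool" where
  "simple_graph V E \<longleftrightarrow> finite V \<and> E \<subseteq> nsets V 2"

definition independence_number :: "'a set \<Rightarrow> 'a set set \<Rightarrow> nat" where
  "independence_number V E = Max (card ` {S. S \<subseteq> V \<and> indep S E})"

definition proper_colouring :: "'a set \<Rightarrow> 'a set set \<Rightarrow> nat \<Rightarrow> ('a \<Rightarrow> nat) \<Rightarrow> bool" where
  "proper_colouring V E k c \<longleftrightarrow>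
     (\<forall>v\<in>V. c v < k) \<and> (\<forall>u\<in>V. \<forall>v\<in>V. {u, v} \<in> E \<longrightarrow> c u \<noteq> c v)"

definition chromatic_number :: "'a set \<Rightarrow> 'a set set \<Rightarrow> nat" where
  "chromatic_number V E = (LEAST k. \<exists>c. proper_colouring V E k c)"

text \<open>A path is given by the list of its vertices, in either of the two directions.\<close>

definition is_path :: "'a set \<Rightarrow> 'a set set \<Rightarrow> 'a list \<Rightarrow> bool" where
  "is_path V E p \<longleftrightarrow> p \<noteq> [] \<and> distinct p \<and> set p \<subseteq> V \<and> successively (\<lambda>u v. {u, v} \<in> E) p"

definition path_edges :: "'a list \<Rightarrow> 'a set set" where
  "path_edges p = {{p ! i, p ! Suc i} | i. Suc i < length p}"

definition path_length :: "'a list \<Rightarrow> nat" where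
  "path_length p = length p - 1"

definition interior_vertices :: "'a list \<Rightarrow> 'a set" where
  "interior_vertices p = set (butlast (tl p))"

text \<open>\<open>immersion W F V E \<phi> P\<close>: the graph \<open>(V, E)\<close> contains the graph \<open>(W, F)\<close> as an immersion, witnessed
  by the vertex map \<open>\<phi>\<close> and the set of paths \<open>P\<close>.\<close>

definition immersion ::
  "'b set \<Rightarrow> 'b set set \<Rightarrow> 'a set \<Rightarrow> 'a set set \<Rightarrow> ('b \<Rightarrow> 'a) \<Rightarrow> 'a list set \<Rightarrow> bool" where
  "immersion W F V E \<phi> P \<longleftrightarrow>
     inj_on \<phi> W \<and> \<phi> ` W \<subseteq> V \<and>
     (\<forall>p\<in>P. is_path V E p) \<and>
     (\<forall>p\<in>P. \<forall>q\<in>P. p \<noteq> q \<longrightarrow> path_edges p \<inter> path_edges q = {}) \<and>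
     (\<forall>u\<in>W. \<forall>v\<in>W. {u, v} \<in> F \<longrightarrow> (\<exists>p\<in>P. {hd p, last p} = {\<phi> u, \<phi> v}))"

definition strong_immersion :: "'b set \<Rightarrow> ('b \<Rightarrow> 'a) \<Rightarrow> 'a list set \<Rightarrow> bool" where
  "strong_immersion W \<phi> P \<longleftrightarrow> (\<forall>p\<in>P. interior_vertices p \<inter> \<phi> ` W = {})"

definition totally_odd :: "'a list set \<Rightarrow> bool" where
  "totally_odd P \<longleftrightarrow> (\<forall>p\<in>P. odd (path_length p))"

text \<open>The complete graph \<open>K\<^sub>t\<close> has vertex set \<open>{..<t}\<close> and edge set \<open>nsets {..<t} 2\<close>.\<close>

definition has_strong_odd_complete_immersion :: "nat \<Rightarrow> 'a set \<Rightarrow> 'a set set \<Rightarrow> bool" where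
  "has_strong_odd_complete_immersion t V E \<longleftrightarrow>
     (\<exists>\<phi> P. immersion {..<t} (nsets {..<t} 2) V E \<phi> P \<and> strong_immersion {..<t} \<phi> P \<and> totally_odd P)"

end

theory Submission
  imports Defs
begin

text \<open>Work in the complement \<open>H\<close>, which is triangle-free, and show that some strong odd clique
  immersion has at least \<open>2/3 \<cdot> (|V| - \<nu>(H))\<close> terminals; matched pairs of \<open>H\<close> can share a colour.

  If \<open>x\<close>, \<open>y\<close> are non-adjacent in \<open>G\<close>, then every other vertex is adjacent to \<open>x\<close> or \<open>y\<close>. Given an
  immersion in \<open>G - {x, y}\<close>, the vertex \<open>x\<close> can be made a terminal by joining it to each non-adjacent
  terminal \<open>a\<close> by a path \<open>x, g a, y, a\<close>, where \<open>g a\<close> are distinct common neighbours of \<open>x\<close> and \<open>y\<close>; all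
  its edges meet \<open>{x, y}\<close>. Since the non-neighbours of a vertex form a clique, there are enough common
  neighbours whenever no large clique exists. This gives \<open>(|V| + 1) / 3\<close> terminals.

  Gallai's lemma reduces to the case \<open>\<nu>(H) = (|V| - 1) / 2\<close>: a vertex covered by all maximum matchings
  of \<open>H\<close> can be deleted, and otherwise \<open>H\<close> is disconnected, where the bound is additive, or
  factor-critical.\<close>

section \<open>Clique immersions\<close>

text \<open>Strong odd complete immersions, with the set \<open>T\<close> of terminals in place of a
  map from \<open>{..<t}\<close>: adding a terminal or merging two immersions then acts on sets, and
  \<open>card T\<close> is the quantity to be bounded. \<open>V\<close> confines the paths, so an
  induced subgraph is obtained by shrinking \<open>V\<close> with \<open>E\<close> fixed.\<close>

definition clique_immersion :: "'a set \<Rightarrow> 'a set set \<Rightarrow> 'a set \<Rightarrow> 'a list set \<Rightarrow> bool" where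
  "clique_immersion V E T P \<longleftrightarrow>
     T \<subseteq> V \<and>
     (\<forall>p\<in>P. is_path V E p \<and> interior_vertices p \<inter> T = {} \<and> odd (path_length p)) \<and>
     (\<forall>p\<in>P. \<forall>q\<in>P. p \<noteq> q \<longrightarrow> path_edges p \<inter> path_edges q = {}) \<and>
     (\<forall>u\<in>T. \<forall>v\<in>T. u \<noteq> v \<longrightarrow> (\<exists>p\<in>P. {hd p, last p} = {u, v}))"

section \<open>Edges of paths and monotonicity\<close>

lemma path_edges_simps [simp]:
  "path_edges [] = {}"
  "path_edges [u] = {}"
  "path_edges (u # v # p) = insert {u, v} (path_edges (v # p))"
proof -
  show "path_edges (u # v # p) = insert {u, v} (path_edges (v # p))"
    unfolding path_edges_def
  proof (intro equalityI subsetI)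
    fix e assume "e \<in> {{(u # v # p) ! i, (u # v # p) ! Suc i} | i. Suc i < length (u # v # p)}"
    then obtain i where "e = {(u # v # p) ! i, (u # v # p) ! Suc i}" "Suc i < length (u # v # p)"
      by blast
    then show "e \<in> insert {u, v} {{(v # p) ! i, (v # p) ! Suc i} | i. Suc i < length (v # p)}"
      by (cases i) auto
  next
    fix e assume "e \<in> insert {u, v} {{(v # p) ! i, (v # p) ! Suc i} | i. Suc i < length (v # p)}"
    then consider "e = {u, v}"
      | i where "e = {(v # p) ! i, (v # p) ! Suc i}" "Suc i < length (v # p)"
      by blast
    then show "e \<in> {{(u # v # p) ! i, (u # v # p) ! Suc i} | i. Suc i < length (u # v # p)}"
    proof cases
      case 1
      then show ?thesis by (intro CollectI exI[of _ 0]) simp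
    next
      case (2 i)
      then show ?thesis by (intro CollectI exI[of _ "Suc i"]) simp
    qed
  qed
qed (simp_all add: path_edges_def)

lemma path_edges_subset: "e \<in> path_edges p \<Longrightarrow> e \<subseteq> set p"
  by (auto simp: path_edges_def)

lemma path_edges_nonempty: "e \<in> path_edges p \<Longrightarrow> e \<noteq> {}"
  by (auto simp: path_edges_def)

lemma interior_subset: "interior_vertices p \<subseteq> set p"
  unfolding interior_vertices_def by (cases p) (auto dest: in_set_butlastD)

lemma is_path_mono: "is_path V E p \<Longrightarrow> V \<subseteq> V' \<Longrightarrow> is_path V' E p"
  by (auto simp: is_path_def)

lemma clique_immersion_mono:
  assumes "clique_immersion V E T P" "V \<subseteq> V'"
  shows "clique_immersion V' E T P"
proof -
  have "T \<subseteq> V'" "\<forall>p\<in>P. is_path V' E p"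
    using assms is_path_mono[of V E _ V'] by (auto simp: clique_immersion_def)
  then show ?thesis
    using assms(1) by (simp add: clique_immersion_def)
qed

lemma clique_immersion_subset:
  assumes "clique_immersion V E T P" "T' \<subseteq> T"
  shows "clique_immersion V E T' P"
proof -
  have "T' \<subseteq> V" "\<forall>p\<in>P. interior_vertices p \<inter> T' = {}"
    using assms by (auto simp: clique_immersion_def)
  moreover have "\<exists>p\<in>P. {hd p, last p} = {u, v}" if "u \<in> T'" "v \<in> T'" "u \<noteq> v" for u v
  proof -
    have "u \<in> T" "v \<in> T"
      using that assms(2) by auto
    then show ?thesis
      using assms(1) \<open>u \<noteq> v\<close> by (simp add: clique_immersion_def)
  qed
  ultimately show ?thesis
    using assms(1) by (simp add: clique_immersion_def)
qed

section \<open>Constructions of clique immersions\<close>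

lemma clique_immersion_empty [simp]: "clique_immersion V E {} {}"
  by (simp add: clique_immersion_def)

lemma clique_immersion_singleton: "v \<in> V \<Longrightarrow> clique_immersion V E {v} {}"
  by (simp add: clique_immersion_def)

text \<open>Two terminals on different sides are joined by their single edge. This edge crosses
  between the sides, whereas each given path stays on one side, so edge-disjointness survives. In
  the complement the hypothesis \<open>join\<close> says that no edge runs between the
  sides.\<close>

lemma clique_immersion_join:
  assumes 1: "clique_immersion V\<^sub>1 E T\<^sub>1 P\<^sub>1" and 2: "clique_immersion V\<^sub>2 E T\<^sub>2 P\<^sub>2"
    and disj: "V\<^sub>1 \<inter> V\<^sub>2 = {}"
    and join: "\<And>a b. a \<in> V\<^sub>1 \<Longrightarrow> b \<in> V\<^sub>2 \<Longrightarrow> {a, b} \<in> E"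
  shows "\<exists>P. clique_immersion (V\<^sub>1 \<union> V\<^sub>2) E (T\<^sub>1 \<union> T\<^sub>2) P"
proof -
  define Q where "Q = {[a, b] | a b. a \<in> T\<^sub>1 \<and> b \<in> T\<^sub>2}"
  have T: "T\<^sub>1 \<subseteq> V\<^sub>1" "T\<^sub>2 \<subseteq> V\<^sub>2"
    using 1 2 by (auto simp: clique_immersion_def)
  have E\<^sub>1: "e \<subseteq> V\<^sub>1" "e \<noteq> {}" if "p \<in> P\<^sub>1" "e \<in> path_edges p" for p e
  proof -
    have "set p \<subseteq> V\<^sub>1"
      using 1 that by (auto simp: clique_immersion_def is_path_def)
    then show "e \<subseteq> V\<^sub>1" "e \<noteq> {}"
      using that path_edges_subset[of e p] path_edges_nonempty[of e p] by auto
  qed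
  have E\<^sub>2: "e \<subseteq> V\<^sub>2" "e \<noteq> {}" if "p \<in> P\<^sub>2" "e \<in> path_edges p" for p e
  proof -
    have "set p \<subseteq> V\<^sub>2"
      using 2 that by (auto simp: clique_immersion_def is_path_def)
    then show "e \<subseteq> V\<^sub>2" "e \<noteq> {}"
      using that path_edges_subset[of e p] path_edges_nonempty[of e p] by auto
  qed
  have I\<^sub>1: "interior_vertices p \<inter> (T\<^sub>1 \<union> T\<^sub>2) = {}" if "p \<in> P\<^sub>1" for p
  proof -
    have "interior_vertices p \<inter> T\<^sub>1 = {}" "set p \<subseteq> V\<^sub>1"
      using 1 that by (auto simp: clique_immersion_def is_path_def)
    then show ?thesis using interior_subset[of p] T disj by blast
  qed
  have I\<^sub>2: "interior_vertices p \<inter> (T\<^sub>1 \<union> T\<^sub>2) = {}" if "p \<in> P\<^sub>2" for p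
  proof -
    have "interior_vertices p \<inter> T\<^sub>2 = {}" "set p \<subseteq> V\<^sub>2"
      using 2 that by (auto simp: clique_immersion_def is_path_def)
    then show ?thesis using interior_subset[of p] T disj by blast
  qed
  have D\<^sub>1\<^sub>2: "path_edges p \<inter> path_edges q = {}" if "p \<in> P\<^sub>1" "q \<in> P\<^sub>2" for p q
  proof (rule ccontr)
    assume "path_edges p \<inter> path_edges q \<noteq> {}"
    then obtain e where "e \<in> path_edges p" "e \<in> path_edges q"
      by blast
    then have "e \<subseteq> V\<^sub>1" "e \<subseteq> V\<^sub>2" "e \<noteq> {}"
      using E\<^sub>1[OF that(1)] E\<^sub>2[OF that(2)] by auto
    then show False
      using disj by blast
  qed
  have D\<^sub>1: "path_edges p \<inter> path_edges q = {}" if pq: "p \<in> P\<^sub>1" "q \<in> Q" for p q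
  proof -
    obtain a b where "q = [a, b]" "b \<in> V\<^sub>2"
      using pq(2) T by (auto simp: Q_def)
    then show ?thesis
      using E\<^sub>1(1)[OF pq(1), of "{a, b}"] disj by auto
  qed
  have D\<^sub>2: "path_edges p \<inter> path_edges q = {}" if pq: "p \<in> P\<^sub>2" "q \<in> Q" for p q
  proof -
    obtain a b where "q = [a, b]" "a \<in> V\<^sub>1"
      using pq(2) T by (auto simp: Q_def)
    then show ?thesis
      using E\<^sub>2(1)[OF pq(1), of "{a, b}"] disj by auto
  qed
  have DQ: "path_edges p \<inter> path_edges q = {}" if pq: "p \<in> Q" "q \<in> Q" "p \<noteq> q" for p q
  proof -
    have "a \<noteq> b" if "a \<in> T\<^sub>1" "b \<in> T\<^sub>2" for a b
      using that T disj by blast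
    then show ?thesis
      using pq by (force simp: Q_def doubleton_eq_iff)
  qed
  have Q: "is_path (V\<^sub>1 \<union> V\<^sub>2) E p \<and> interior_vertices p \<inter> (T\<^sub>1 \<union> T\<^sub>2) = {} \<and> odd (path_length p)"
    if "p \<in> Q" for p
  proof -
    obtain a b where "p = [a, b]" "a \<in> V\<^sub>1" "b \<in> V\<^sub>2"
      using \<open>p \<in> Q\<close> T by (auto simp: Q_def)
    moreover from this have "a \<noteq> b"
      using disj by blast
    ultimately show ?thesis
      using join by (simp add: is_path_def interior_vertices_def path_length_def)
  qed
  have "clique_immersion (V\<^sub>1 \<union> V\<^sub>2) E (T\<^sub>1 \<union> T\<^sub>2) (P\<^sub>1 \<union> P\<^sub>2 \<union> Q)"
    unfolding clique_immersion_def
  proof (intro conjI)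
    show "T\<^sub>1 \<union> T\<^sub>2 \<subseteq> V\<^sub>1 \<union> V\<^sub>2"
      using T by blast
    show "\<forall>p\<in>P\<^sub>1 \<union> P\<^sub>2 \<union> Q. is_path (V\<^sub>1 \<union> V\<^sub>2) E p \<and>
        interior_vertices p \<inter> (T\<^sub>1 \<union> T\<^sub>2) = {} \<and> odd (path_length p)"
    proof
      fix p assume "p \<in> P\<^sub>1 \<union> P\<^sub>2 \<union> Q"
      then consider "p \<in> P\<^sub>1" | "p \<in> P\<^sub>2" | "p \<in> Q"
        by blast
      then show "is_path (V\<^sub>1 \<union> V\<^sub>2) E p \<and>
        interior_vertices p \<inter> (T\<^sub>1 \<union> T\<^sub>2) = {} \<and> odd (path_length p)"
      proof cases
        case 1
        then have "is_path V\<^sub>1 E p" "odd (path_length p)"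
          using assms(1) by (auto simp: clique_immersion_def)
        then show ?thesis using I\<^sub>1[OF 1] is_path_mono[of V\<^sub>1] by blast
      next
        case 2
        then have "is_path V\<^sub>2 E p" "odd (path_length p)"
          using assms(2) by (auto simp: clique_immersion_def)
        then show ?thesis using I\<^sub>2[OF 2] is_path_mono[of V\<^sub>2] by blast
      next
        case 3
        then show ?thesis by (rule Q)
      qed
    qed
    show "\<forall>p\<in>P\<^sub>1 \<union> P\<^sub>2 \<union> Q. \<forall>q\<in>P\<^sub>1 \<union> P\<^sub>2 \<union> Q. p \<noteq> q \<longrightarrow> path_edges p \<inter> path_edges q = {}"
    proof (intro ballI impI)
      fix p q assume "p \<in> P\<^sub>1 \<union> P\<^sub>2 \<union> Q" "q \<in> P\<^sub>1 \<union> P\<^sub>2 \<union> Q" "p \<noteq> q"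
      then consider "p \<in> P\<^sub>1" "q \<in> P\<^sub>1" | "p \<in> P\<^sub>2" "q \<in> P\<^sub>2" | "p \<in> Q" "q \<in> Q"
        | "p \<in> P\<^sub>1" "q \<in> P\<^sub>2" | "q \<in> P\<^sub>1" "p \<in> P\<^sub>2" | "p \<in> P\<^sub>1" "q \<in> Q" | "q \<in> P\<^sub>1" "p \<in> Q"
        | "p \<in> P\<^sub>2" "q \<in> Q" | "q \<in> P\<^sub>2" "p \<in> Q"
        by blast
      then show "path_edges p \<inter> path_edges q = {}"
      proof cases
        case 1
        then show ?thesis using assms(1) \<open>p \<noteq> q\<close> by (auto simp: clique_immersion_def)
      next
        case 2
        then show ?thesis using assms(2) \<open>p \<noteq> q\<close> by (auto simp: clique_immersion_def)
      next
        case 3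
        then show ?thesis using DQ \<open>p \<noteq> q\<close> by simp
      qed (use D\<^sub>1\<^sub>2 D\<^sub>1 D\<^sub>2 in blast)+
    qed
    show "\<forall>u\<in>T\<^sub>1 \<union> T\<^sub>2. \<forall>v\<in>T\<^sub>1 \<union> T\<^sub>2. u \<noteq> v \<longrightarrow> (\<exists>p\<in>P\<^sub>1 \<union> P\<^sub>2 \<union> Q. {hd p, last p} = {u, v})"
    proof (intro ballI impI)
      fix u v assume "u \<in> T\<^sub>1 \<union> T\<^sub>2" "v \<in> T\<^sub>1 \<union> T\<^sub>2" "u \<noteq> v"
      then consider "u \<in> T\<^sub>1" "v \<in> T\<^sub>1" | "u \<in> T\<^sub>2" "v \<in> T\<^sub>2"
        | "[u, v] \<in> Q" | "[v, u] \<in> Q"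
        by (auto simp: Q_def)
      then show "\<exists>p\<in>P\<^sub>1 \<union> P\<^sub>2 \<union> Q. {hd p, last p} = {u, v}"
      proof cases
        case 1
        then show ?thesis using assms(1) \<open>u \<noteq> v\<close> by (simp add: clique_immersion_def bex_Un)
      next
        case 2
        then show ?thesis using assms(2) \<open>u \<noteq> v\<close> by (simp add: clique_immersion_def bex_Un)
      next
        case 3
        then show ?thesis by (intro bexI[of _ "[u, v]"]) auto
      next
        case 4
        then show ?thesis by (intro bexI[of _ "[v, u]"]) auto
      qed
    qed
  qed
  then show ?thesis ..
qed

lemma clique_imp_clique_immersion:
  assumes "finite K" "clique K E"
  shows "\<exists>P. clique_immersion K E K P"
  using assms
proof (induction K rule: finite_induct)
  case empty
  then show ?case using clique_immersion_empty by blast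
next
  case (insert x K)
  then obtain P where P: "clique_immersion K E K P"
    using smaller_clique by blast
  have "{a, b} \<in> E" if "a \<in> {x}" "b \<in> K" for a b
    using insert.prems insert.hyps that by (auto simp: clique_def)
  then show ?case
    using clique_immersion_join[OF clique_immersion_singleton[of x "{x}"] P] insert.hyps by auto
qed

text \<open>The vertex \<open>y\<close> is sacrificed: it stays outside the terminals, so it may be
  an interior vertex of every detour from \<open>x\<close>, and each detour has three edges. Since
  the given paths avoid \<open>x\<close> and \<open>y\<close>, all edges at these two vertices are
  free for the new paths.\<close>

lemma clique_immersion_extend:
  assumes imm: "clique_immersion (V - {x, y}) E T P"
    and xy: "x \<in> V" "y \<in> V" "x \<noteq> y"
    and inj: "inj_on g {a \<in> T. {x, a} \<notin> E}"
    and g: "\<And>a. a \<in> T \<Longrightarrow> {x, a} \<notin> E \<Longrightarrow>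
      {y, a} \<in> E \<and> g a \<in> V - {x, y} - T \<and> {x, g a} \<in> E \<and> {y, g a} \<in> E"
  shows "\<exists>P'. clique_immersion V E (insert x T) P'"
proof -
  define f where "f a = (if {x, a} \<in> E then [x, a] else [x, g a, y, a])" for a
  have T: "T \<subseteq> V" "x \<notin> T" "y \<notin> T"
    using imm by (auto simp: clique_immersion_def)
  have f: "is_path V E (f a) \<and> interior_vertices (f a) \<inter> insert x T = {} \<and> odd (path_length (f a))"
    if "a \<in> T" for a
  proof (cases "{x, a} \<in> E")
    case True
    then show ?thesis
      using that T xy by (auto simp: f_def is_path_def interior_vertices_def path_length_def)
  next
    case False
    note ga = g[OF that False]
    then have "{g a, y} \<in> E"
      by (simp add: insert_commute)
    then show ?thesis
      using that T xy ga False
      by (auto simp: f_def is_path_def interior_vertices_def path_length_def)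
  qed
  have ends: "hd (f a) = x" "last (f a) = a" for a
    by (auto simp: f_def)
  have old: "e \<subseteq> V - {x, y}" if "p \<in> P" "e \<in> path_edges p" for p e
  proof -
    have "set p \<subseteq> V - {x, y}"
      using imm that(1) by (auto simp: clique_immersion_def is_path_def)
    then show ?thesis
      using path_edges_subset[OF that(2)] by blast
  qed
  have new: "x \<in> e \<or> y \<in> e" if "e \<in> path_edges (f a)" for a e
    using that by (auto simp: f_def split: if_splits)
  \<comment> \<open>Two detours have different middle edges because \<open>g\<close> is injective,
    and their last edges differ in \<open>a\<close>. Since \<open>g\<close> takes values outside
    \<open>T\<close>, the edges from \<open>x\<close> and \<open>y\<close> to \<open>g a\<close> are
    neither direct edges \<open>{x, b}\<close> nor last edges \<open>{y, b}\<close>.\<close>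
  have ff: "path_edges (f a) \<inter> path_edges (f b) = {}" if "a \<in> T" "b \<in> T" "a \<noteq> b" for a b
  proof -
    have "g a \<noteq> g b" if "{x, a} \<notin> E" "{x, b} \<notin> E"
      using inj \<open>a \<in> T\<close> \<open>b \<in> T\<close> \<open>a \<noteq> b\<close> that by (auto dest: inj_onD)
    moreover have "g a \<notin> insert x (insert y T)" if "{x, a} \<notin> E"
      using g[OF \<open>a \<in> T\<close> that] by blast
    moreover have "g b \<notin> insert x (insert y T)" if "{x, b} \<notin> E"
      using g[OF \<open>b \<in> T\<close> that] by blast
    ultimately show ?thesis
      using that T xy by (auto simp: f_def doubleton_eq_iff)
  qed
  have "clique_immersion V E (insert x T) (P \<union> f ` T)"
    unfolding clique_immersion_def
  proof (intro conjI)
    show "insert x T \<subseteq> V"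
      using T xy by blast
    show "\<forall>p\<in>P \<union> f ` T. is_path V E p \<and> interior_vertices p \<inter> insert x T = {} \<and> odd (path_length p)"
    proof
      fix p assume "p \<in> P \<union> f ` T"
      then show "is_path V E p \<and> interior_vertices p \<inter> insert x T = {} \<and> odd (path_length p)"
      proof
        assume "p \<in> P"
        then have *: "is_path (V - {x, y}) E p" "interior_vertices p \<inter> T = {}" "odd (path_length p)"
          using imm by (auto simp: clique_immersion_def)
        then have "set p \<subseteq> V - {x, y}"
          by (simp add: is_path_def)
        then have "x \<notin> interior_vertices p"
          using interior_subset[of p] by blast
        then show ?thesis
          using * is_path_mono[of "V - {x, y}" E p V] by blast
      qed (use f in blast)
    qed
    show "\<forall>p\<in>P \<union> f ` T. \<forall>q\<in>P \<union> f ` T. p \<noteq> q \<longrightarrow> path_edges p \<inter> path_edges q = {}"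
    proof (intro ballI impI)
      fix p q assume "p \<in> P \<union> f ` T" "q \<in> P \<union> f ` T" "p \<noteq> q"
      then consider "p \<in> P" "q \<in> P" | a where "p \<in> P" "q = f a" | a where "q \<in> P" "p = f a"
        | a b where "p = f a" "q = f b" "a \<in> T" "b \<in> T" "a \<noteq> b"
        by blast
      then show "path_edges p \<inter> path_edges q = {}"
      proof cases
        case 1
        then show ?thesis using imm \<open>p \<noteq> q\<close> by (simp add: clique_immersion_def)
      next
        case 2
        then show ?thesis using old new by blast
      next
        case 3
        then show ?thesis using old new by blast
      next
        case 4
        then show ?thesis using ff by blast
      qed
    qed
    show "\<forall>u\<in>insert x T. \<forall>v\<in>insert x T. u \<noteq> v \<longrightarrow> (\<exists>p\<in>P \<union> f ` T. {hd p, last p} = {u, v})"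
    proof (intro ballI impI)
      fix u v assume "u \<in> insert x T" "v \<in> insert x T" "u \<noteq> v"
      then consider "u \<in> T" "v \<in> T" | "u = x" "v \<in> T" | "v = x" "u \<in> T"
        by blast
      then show "\<exists>p\<in>P \<union> f ` T. {hd p, last p} = {u, v}"
      proof cases
        case 1
        then show ?thesis using imm \<open>u \<noteq> v\<close> by (simp add: clique_immersion_def bex_Un)
      next
        case 2
        then show ?thesis using ends by (intro bexI[of _ "f v"]) auto
      next
        case 3
        then show ?thesis using ends by (intro bexI[of _ "f u"]) auto
      qed
    qed
  qed
  then show ?thesis ..
qed

lemma clique_immersion_imp_has_strong_odd_complete_immersion:
  assumes "finite V" "clique_immersion V E T P" "t \<le> card T"
  shows "has_strong_odd_complete_immersion t V E"
proof -
  obtain T' where T': "T' \<subseteq> T" "card T' = t"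
    using assms(3) by (meson obtain_subset_with_card_n)
  then have imm: "clique_immersion V E T' P"
    using assms(2) clique_immersion_subset by blast
  then have "finite T'"
    using assms(1) finite_subset unfolding clique_immersion_def by blast
  then obtain \<phi> where \<phi>: "bij_betw \<phi> {..<t} T'"
    using T'(2) ex_bij_betw_nat_finite[of T'] by (auto simp: atLeast0LessThan)
  have im: "\<phi> ` {..<t} = T'"
    using \<phi> by (simp add: bij_betw_def)
  have "\<exists>p\<in>P. {hd p, last p} = {\<phi> u, \<phi> v}" if "u < t" "v < t" "u \<noteq> v" for u v
  proof -
    have "\<phi> u \<in> T'" "\<phi> v \<in> T'" "\<phi> u \<noteq> \<phi> v"
      using that \<phi> by (auto simp: bij_betw_def inj_on_def)
    then show ?thesis
      using imm by (simp add: clique_immersion_def)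
  qed
  then show ?thesis
    using imm \<phi> im
    unfolding has_strong_odd_complete_immersion_def immersion_def strong_immersion_def
      totally_odd_def clique_immersion_def bij_betw_def
    by (intro exI[of _ \<phi>] exI[of _ P]) auto
qed

section \<open>The bound in terms of the number of vertices\<close>

lemma triple_edge:
  assumes "\<forall>S\<subseteq>V. indep S E \<longrightarrow> card S \<le> 2" "u \<in> V" "v \<in> V" "w \<in> V" "u \<noteq> v" "v \<noteq> w" "u \<noteq> w"
  shows "{u, v} \<in> E \<or> {v, w} \<in> E \<or> {u, w} \<in> E"
proof (rule ccontr)
  assume "\<not> ?thesis"
  moreover from this have "{v, u} \<notin> E" "{w, v} \<notin> E" "{w, u} \<notin> E"
    by (simp_all add: insert_commute)
  ultimately have "indep {u, v, w} E"
    by (simp add: indep_def)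
  then have "card {u, v, w} \<le> 2"
    using assms(1-4) by simp
  then show False
    using assms by simp
qed

text \<open>Two non-adjacent vertices in this set would form an independent triple with
  \<open>x\<close>.\<close>

lemma clique_nonneighbours:
  assumes "\<forall>S\<subseteq>V. indep S E \<longrightarrow> card S \<le> 2" "x \<in> V"
  shows "clique {z \<in> V - {x}. {x, z} \<notin> E} E"
  unfolding clique_def
proof (intro ballI impI)
  fix u v
  assume "u \<in> {z \<in> V - {x}. {x, z} \<notin> E}" "v \<in> {z \<in> V - {x}. {x, z} \<notin> E}" "u \<noteq> v"
  then show "{u, v} \<in> E"
    using triple_edge[OF assms, of u v] by auto
qed

text \<open>The induction removes a non-adjacent pair, which lowers \<open>card V\<close> by 2, so
  one additional terminal is enough to restore the bound. It is needed only if
  \<open>card V \<ge> 3 * card T\<close>, and that inequality pays for the detours.\<close>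

lemma large_clique_immersion:
  assumes "finite V" "V \<noteq> {}" "\<forall>S\<subseteq>V. indep S E \<longrightarrow> card S \<le> 2"
  shows "\<exists>T P. clique_immersion V E T P \<and> card V + 1 \<le> 3 * card T"
  using assms
proof (induction "card V" arbitrary: V rule: less_induct)
  case less
  note fin = \<open>finite V\<close> and alpha = less.prems(3)
  have pos: "card V > 0"
    using less.prems by (simp add: card_gt_0_iff)
  show ?case
  proof (cases "clique V E")
    case True
    then obtain P where "clique_immersion V E V P"
      using clique_imp_clique_immersion[OF fin] by blast
    then show ?thesis using pos by (intro exI[of _ V] exI[of _ P]) auto
  next
    case False
    then obtain x y where xy: "x \<in> V" "y \<in> V" "x \<noteq> y" "{x, y} \<notin> E"
      by (auto simp: clique_def)
    define W where "W = V - {x, y}"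
    have cW: "card V = card W + 2"
      using xy fin card_Diff_subset[of "{x, y}" V] card_mono[of V "{x, y}"] by (simp add: W_def)
    show ?thesis
    \<comment> \<open>The induction hypothesis excludes the empty set, where the bound would read
      \<open>1 \<le> 0\<close>.\<close>
    proof (cases "W = {}")
      case True
      then show ?thesis
        using cW clique_immersion_singleton[OF xy(1)] by (intro exI[of _ "{x}"] exI[of _ "{}"]) auto
    next
      case False
      have "W \<subseteq> V"
        by (auto simp: W_def)
      then have "\<forall>S\<subseteq>W. indep S E \<longrightarrow> card S \<le> 2"
        using alpha by (meson order_trans)
      moreover have "finite W" "card W < card V"
        using \<open>W \<subseteq> V\<close> fin cW finite_subset by auto
      ultimately obtain T P where TP: "clique_immersion W E T P" "card W + 1 \<le> 3 * card T"
        using less.hyps False by blast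
      have TW: "T \<subseteq> W"
        using TP by (simp add: clique_immersion_def)
      show ?thesis
      proof (cases "card V + 1 \<le> 3 * card T")
        case True
        then show ?thesis
          using clique_immersion_mono[OF TP(1), of V] by (auto simp: W_def)
      next
        case not_yet: False
        define X where "X = {z \<in> V - {x}. {x, z} \<notin> E}"
        define Y where "Y = {z \<in> V - {y}. {y, z} \<notin> E}"
        have cl: "clique X E" "clique Y E"
          using clique_nonneighbours[OF alpha] xy unfolding X_def Y_def by auto
        have sub: "X \<subseteq> V" "Y \<subseteq> V"
          by (auto simp: X_def Y_def)
        then have finXY: "finite X" "finite Y"
          using fin finite_subset by auto
        \<comment> \<open>A clique with one vertex more than \<open>T\<close> already suffices,
          because \<open>card V + 1 \<le> 3 * card T + 2\<close> by the induction
          hypothesis.\<close>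
        have big: ?thesis if K: "clique K E" "K \<subseteq> V" "card K > card T" for K
        proof -
          obtain P' where "clique_immersion K E K P'"
            using clique_imp_clique_immersion[OF finite_subset[OF K(2) fin] K(1)] by blast
          then have "clique_immersion V E K P'"
            using clique_immersion_mono K(2) by blast
          then show ?thesis
            using K(3) TP(2) cW by (intro exI[of _ K] exI[of _ P']) auto
        qed
        show ?thesis
        proof (cases "card X > card T \<or> card Y > card T")
          case True
          then show ?thesis using big cl sub by blast
        next
          case small: False
          \<comment> \<open>\<open>A\<close> collects the terminals that need a detour,
            \<open>C\<close> the common neighbours of \<open>x\<close> and \<open>y\<close> that are
            not terminals.\<close>
          define A where "A = {a \<in> T. {x, a} \<notin> E}"
          define C where "C = W - (X \<union> Y) - T"
          have disj: "X \<inter> Y = {}"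
          proof -
            have False if "z \<in> X" "z \<in> Y" for z
            proof -
              have "z \<in> V" "x \<noteq> z" "y \<noteq> z" "{x, z} \<notin> E" "{y, z} \<notin> E"
                using that by (auto simp: X_def Y_def)
              then show False
                using triple_edge[OF alpha xy(1,2), of z] xy(3,4) by simp
            qed
            then show ?thesis by blast
          qed
          \<comment> \<open>As \<open>y\<close> is in \<open>X\<close> and \<open>x\<close> in
            \<open>Y\<close>, removing \<open>X\<close> and \<open>Y\<close> from \<open>V\<close>
            leaves exactly the common neighbours, with no further loss for \<open>x\<close> and
            \<open>y\<close>.\<close>
          have "{y, x} \<notin> E"
            using xy(4) by (simp add: insert_commute)
          then have "y \<in> X" "x \<in> Y"
            using xy by (simp_all add: X_def Y_def)
          then have eq: "V - (X \<union> Y) = W - (X \<union> Y)"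
            by (auto simp: W_def)
          have AX: "A \<subseteq> X"
            using TW unfolding A_def X_def W_def by blast
          have finT: "finite T"
            using TW fin finite_subset by (auto simp: W_def)
          have "card (V - (X \<union> Y)) = card V - (card X + card Y)"
            using disj finXY sub by (simp add: card_Diff_subset card_Un_disjoint)
          then have cV: "card V - 2 * card T \<le> card (W - (X \<union> Y))"
            using small unfolding eq by linarith
          \<comment> \<open>Terminals in \<open>A\<close> lie in \<open>X\<close> and are not common
            neighbours, so only \<open>T - A\<close> has to be subtracted. There are at least
            \<open>card V - 2 * card T \<ge> card T\<close> common neighbours, hence at least
            \<open>card A\<close> remain.\<close>
          have "C = W - (X \<union> Y) - (T - A)"
            using AX unfolding C_def by blast
          then have "card (W - (X \<union> Y)) - card (T - A) \<le> card C"
            using finT diff_card_le_card_Diff[of "T - A"] by simp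
          moreover have "card (T - A) = card T - card A" "card A \<le> card T"
            using finT by (auto simp: A_def card_Diff_subset intro: card_mono)
          ultimately have "card A \<le> card C"
            using cV not_yet by linarith
          then obtain g where g: "g ` A \<subseteq> C" "inj_on g A"
            using card_le_inj[of A C] finT fin by (auto simp: A_def C_def W_def)
          have "{y, a} \<in> E \<and> g a \<in> V - {x, y} - T \<and> {x, g a} \<in> E \<and> {y, g a} \<in> E"
            if "a \<in> T" "{x, a} \<notin> E" for a
          proof -
            have "a \<in> A" "a \<in> V - {x, y}"
              using that TW by (auto simp: A_def W_def)
            moreover from this have "a \<notin> Y" "g a \<in> C"
              using AX disj g by auto
            moreover from this have "g a \<in> V - {x, y} - T" "g a \<notin> X" "g a \<notin> Y"
              by (auto simp: C_def W_def)
            ultimately show ?thesis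
              by (simp add: X_def Y_def)
          qed
          then obtain P' where "clique_immersion V E (insert x T) P'"
            using clique_immersion_extend[OF TP(1)[unfolded W_def] xy(1-3), of g] g(2)
            unfolding A_def by blast
          moreover have "card (insert x T) = card T + 1"
          proof -
            have "x \<notin> T"
              using TW by (auto simp: W_def)
            then show ?thesis
              using finT by simp
          qed
          ultimately show ?thesis
            using TP(2) cW by (intro exI[of _ "insert x T"] exI[of _ P']) auto
        qed
      qed
    qed
  qed
qed

section \<open>Matchings in the complement\<close>

text \<open>The matchings of the complement graph, stated without forming that graph.\<close>

definition nonedge_matching :: "'a set \<Rightarrow> 'a set set \<Rightarrow> 'a set set \<Rightarrow> bool" where
  "nonedge_matching V E M \<longleftrightarrow> M \<subseteq> nsets V 2 \<and> M \<inter> E = {} \<and> pairwise disjnt M"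

definition maximum_nonedge_matching :: "'a set \<Rightarrow> 'a set set \<Rightarrow> 'a set set \<Rightarrow> bool" where
  "maximum_nonedge_matching V E M \<longleftrightarrow>
     nonedge_matching V E M \<and> (\<forall>N. nonedge_matching V E N \<longrightarrow> card N \<le> card M)"

lemma nonedge_matching_empty [simp]: "nonedge_matching V E {}"
  by (simp add: nonedge_matching_def)

lemma nonedge_matching_finite:
  "finite V \<Longrightarrow> nonedge_matching V E M \<Longrightarrow> finite M"
  unfolding nonedge_matching_def by (meson finite_imp_finite_nsets finite_subset)

lemma nonedge_matching_mono:
  "nonedge_matching V E M \<Longrightarrow> V \<subseteq> V' \<Longrightarrow> nonedge_matching V' E M"
  unfolding nonedge_matching_def by (meson nsets_mono order_trans)

lemma nonedge_matching_subset:
  "nonedge_matching V E M \<Longrightarrow> N \<subseteq> M \<Longrightarrow> nonedge_matching V E N"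
  unfolding nonedge_matching_def by (meson disjoint_iff order_trans pairwise_subset subset_iff)

lemma nonedge_matching_Union_subset: "nonedge_matching V E M \<Longrightarrow> \<Union>M \<subseteq> V"
  by (auto simp: nonedge_matching_def nsets_def)

lemma card_Union_nonedge_matching:
  assumes "nonedge_matching V E M"
  shows "card (\<Union>M) = 2 * card M"
proof -
  have *: "finite e \<and> card e = 2" if "e \<in> M" for e
    using assms that by (auto simp: nonedge_matching_def nsets_def)
  then have "card (\<Union>M) = sum card M"
    using assms by (intro card_Union_disjoint) (auto simp: nonedge_matching_def)
  also have "\<dots> = 2 * card M"
    using * by simp
  finally show ?thesis .
qed

lemma nonedge_matching_insert:
  assumes "nonedge_matching V E M" "x \<in> V - \<Union>M" "y \<in> V - \<Union>M" "x \<noteq> y" "{x, y} \<notin> E"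
  shows "nonedge_matching V E (insert {x, y} M)"
  using assms unfolding nonedge_matching_def
  by (auto simp: pairwise_insert disjnt_def)

lemma ex_maximum_nonedge_matching:
  assumes "finite V"
  shows "\<exists>M. maximum_nonedge_matching V E M"
proof -
  have "card N < Suc (card V)" if "nonedge_matching V E N" for N
    using card_Union_nonedge_matching[OF that] card_mono[OF assms nonedge_matching_Union_subset[OF that]]
    by simp
  then show ?thesis
    unfolding maximum_nonedge_matching_def
    using ex_has_greatest_nat[of "nonedge_matching V E" "{}" card "Suc (card V)"] by simp
qed

lemma maximum_nonedge_matching_missed_edge:
  assumes "finite V" "maximum_nonedge_matching V E M" "x \<in> V - \<Union>M" "y \<in> V - \<Union>M" "x \<noteq> y"
  shows "{x, y} \<in> E"
proof (rule ccontr)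
  assume "{x, y} \<notin> E"
  then have "nonedge_matching V E (insert {x, y} M)"
    using nonedge_matching_insert[OF _ assms(3-5)] assms(2) by (simp add: maximum_nonedge_matching_def)
  then have "card (insert {x, y} M) \<le> card M"
    using assms by (auto simp: maximum_nonedge_matching_def)
  moreover have "finite M" "{x, y} \<notin> M"
    using assms nonedge_matching_finite by (auto simp: maximum_nonedge_matching_def)
  ultimately show False
    by simp
qed

text \<open>Gallai's lemma: among the maximum matchings \<open>N\<close> missing \<open>v\<close>, take one sharing the most edges
  with \<open>M\<close>. By counting, \<open>N\<close> misses another vertex \<open>y\<close> that \<open>M\<close> covers, and exchanging the \<open>N\<close>-edge at
  the \<open>M\<close>-partner of \<open>y\<close> for the \<open>M\<close>-edge at \<open>y\<close> increases the overlap.\<close>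

lemma maximum_nonedge_matching_missed_trans:
  assumes fin: "finite V"
    and M: "maximum_nonedge_matching V E M" "u \<in> V - \<Union>M" "w \<in> V - \<Union>M" "u \<noteq> w"
    and N: "maximum_nonedge_matching V E N" "v \<in> V - \<Union>N" "v \<noteq> u" "v \<noteq> w"
  shows "\<exists>L. maximum_nonedge_matching V E L \<and> v \<in> V - \<Union>L \<and> (u \<in> V - \<Union>L \<or> w \<in> V - \<Union>L)"
proof (rule ccontr)
  assume contra: "\<not> ?thesis"
  define Q where "Q L \<longleftrightarrow> maximum_nonedge_matching V E L \<and> v \<in> V - \<Union>L" for L
  have finM: "finite M"
    using M fin nonedge_matching_finite by (auto simp: maximum_nonedge_matching_def)
  have "card (M \<inter> L') < Suc (card M)" for L'
    using finM by (simp add: card_mono less_Suc_eq_le)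
  then have "\<exists>L. Q L \<and> (\<forall>L'. Q L' \<longrightarrow> card (M \<inter> L') \<le> card (M \<inter> L))"
    using ex_has_greatest_nat[of Q N "\<lambda>L. card (M \<inter> L)" "Suc (card M)"] N by (simp add: Q_def)
  then obtain L where L: "maximum_nonedge_matching V E L" "v \<in> V - \<Union>L"
    and greatest: "\<And>L'. Q L' \<Longrightarrow> card (M \<inter> L') \<le> card (M \<inter> L)"
    unfolding Q_def by blast
  have mM: "nonedge_matching V E M" and mL: "nonedge_matching V E L"
    using M L by (auto simp: maximum_nonedge_matching_def)
  have finL: "finite L"
    using mL fin nonedge_matching_finite by auto
  have uw: "u \<in> \<Union>L" "w \<in> \<Union>L"
    using contra L M by blast+
  have cardeq: "card L = card M"
    using M L by (meson maximum_nonedge_matching_def le_antisym)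
  have subs: "\<Union>M \<subseteq> V" "\<Union>L \<subseteq> V"
    by (fact nonedge_matching_Union_subset[OF mM] nonedge_matching_Union_subset[OF mL])+
  have finU: "finite (\<Union>M)" "finite (\<Union>L)"
    by (rule finite_subset[OF subs(1) fin], rule finite_subset[OF subs(2) fin])
  \<comment> \<open>\<open>M\<close> and \<open>L\<close> cover equally many vertices. Both
    \<open>u\<close> and \<open>w\<close> are covered by \<open>L\<close> only, so at least two
    vertices are covered by \<open>M\<close> only, and one of them differs from
    \<open>v\<close>.\<close>
  have "card (\<Union>M - \<Union>L) = card (\<Union>L - \<Union>M)"
  proof -
    have "card (\<Union>M) = card (\<Union>L)"
      using card_Union_nonedge_matching[OF mM] card_Union_nonedge_matching[OF mL] cardeq by simp
    then show ?thesis
      using card_Diff_subset_Int[of "\<Union>M" "\<Union>L"] card_Diff_subset_Int[of "\<Union>L" "\<Union>M"] finU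
      by (simp add: Int_commute)
  qed
  moreover have "card {u, w} \<le> card (\<Union>L - \<Union>M)"
    using uw M finU by (intro card_mono) auto
  ultimately have "\<not> \<Union>M - \<Union>L \<subseteq> {v}"
    using M(4) card_mono[of "{v}" "\<Union>M - \<Union>L"] by auto
  then obtain y where y: "y \<in> \<Union>M" "y \<notin> \<Union>L" "y \<noteq> v"
    by blast
  then obtain e where e: "e \<in> M" "y \<in> e"
    by blast
  then obtain y' where y': "e = {y, y'}" "y \<noteq> y'"
    using mM unfolding nonedge_matching_def by (auto elim!: nsets2_E)
  have in_V: "y \<in> V" "y' \<in> V"
    using e y' subs by auto
  have e_nonedge: "{y, y'} \<notin> E"
    using e y' mM by (auto simp: nonedge_matching_def)
  \<comment> \<open>Otherwise \<open>{y, y'}\<close> could be added to \<open>L\<close>.\<close>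
  then have "y' \<in> \<Union>L"
    using maximum_nonedge_matching_missed_edge[OF fin L(1), of y y'] in_V y y' by blast
  then obtain d where d: "d \<in> L" "y' \<in> d"
    by blast
  \<comment> \<open>The edge \<open>d\<close> to be discarded meets \<open>e\<close> in
    \<open>y'\<close>, so it is not in \<open>M\<close>: the exchange removes nothing from the
    overlap.\<close>
  have "d \<noteq> e"
    using y(2) e(2) d(1) by blast
  moreover have "\<not> disjnt d e"
    using d(2) y'(1) by (auto simp: disjnt_def)
  ultimately have "d \<notin> M"
    using e(1) mM by (auto simp: nonedge_matching_def pairwise_def)
  have y'_missed: "y' \<notin> \<Union>(L - {d})"
  proof
    assume "y' \<in> \<Union>(L - {d})"
    then obtain d' where d': "d' \<in> L" "d' \<noteq> d" "y' \<in> d'"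
      by blast
    then have "disjnt d' d"
      using d(1) mL by (simp add: nonedge_matching_def pairwise_def)
    then show False
      using d(2) d'(3) by (auto simp: disjnt_def)
  qed
  define L' where "L' = insert {y, y'} (L - {d})"
  have "nonedge_matching V E L'"
    unfolding L'_def
  proof (rule nonedge_matching_insert)
    show "nonedge_matching V E (L - {d})"
      by (rule nonedge_matching_subset[OF mL Diff_subset])
    show "y \<in> V - \<Union>(L - {d})"
      using in_V(1) y(2) by blast
    show "y' \<in> V - \<Union>(L - {d})"
      using in_V(2) y'_missed by blast
  qed (use y'(2) e_nonedge in auto)
  moreover have "{y, y'} \<notin> L"
    using y by auto
  then have "card L' = card L"
    unfolding L'_def using finL card_Suc_Diff1[OF finL d(1)] by simp
  ultimately have "maximum_nonedge_matching V E L'"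
    using L(1) by (simp add: maximum_nonedge_matching_def)
  moreover have "v \<in> V - \<Union>L'"
  proof -
    have "v \<noteq> y'"
      using L(2) \<open>y' \<in> \<Union>L\<close> by blast
    then show ?thesis
      using L(2) y(3) unfolding L'_def by blast
  qed
  ultimately have "card (M \<inter> L') \<le> card (M \<inter> L)"
    using greatest by (simp add: Q_def)
  moreover have "M \<inter> L' = insert {y, y'} (M \<inter> L)"
    using e(1) y'(1) \<open>d \<notin> M\<close> unfolding L'_def by blast
  ultimately show False
    using \<open>{y, y'} \<notin> L\<close> finM by simp
qed

section \<open>Matchings and immersions\<close>

text \<open>The left-hand side is twice the number of colours obtained when every pair of
  \<open>M\<close> shares a colour. Asking for some matching instead of a maximum one lets matchings
  of two parts be combined without any maximality to check.\<close>

lemma ex_nonedge_matching_clique_immersion: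
  assumes "finite V" "\<forall>S\<subseteq>V. indep S E \<longrightarrow> card S \<le> 2"
  shows "\<exists>M T P. nonedge_matching V E M \<and> clique_immersion V E T P \<and>
    2 * (card V - card M) \<le> 3 * card T"
  using assms
proof (induction "card V" arbitrary: V rule: less_induct)
  case less
  note fin = \<open>finite V\<close> and alpha = less.prems(2)
  have IH: "\<exists>M T P. nonedge_matching W E M \<and> clique_immersion W E T P \<and>
    2 * (card W - card M) \<le> 3 * card T" if "W \<subset> V" for W
  proof (rule less.hyps)
    show "card W < card V" "finite W"
      using that fin psubset_card_mono finite_subset by auto
    show "\<forall>S\<subseteq>W. indep S E \<longrightarrow> card S \<le> 2"
      using that alpha by blast
  qed
  show ?case
  proof (cases "\<forall>v\<in>V. \<exists>M. maximum_nonedge_matching V E M \<and> v \<in> V - \<Union>M")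
    case False
    then obtain v where v: "v \<in> V" "\<And>M. maximum_nonedge_matching V E M \<Longrightarrow> v \<in> \<Union>M"
      by blast
    then obtain M T P where MTP: "nonedge_matching (V - {v}) E M" "clique_immersion (V - {v}) E T P"
      "2 * (card (V - {v}) - card M) \<le> 3 * card T"
      using IH[of "V - {v}"] by blast
    have "nonedge_matching V E M"
      using MTP(1) nonedge_matching_mono by blast
    moreover have "v \<notin> \<Union>M"
      using nonedge_matching_Union_subset[OF MTP(1)] by blast
    \<comment> \<open>\<open>M\<close> misses \<open>v\<close>, so it is not a maximum matching of
      \<open>V\<close>; a larger \<open>N\<close> makes up for the return of
      \<open>v\<close>.\<close>
    ultimately obtain N where "nonedge_matching V E N" "card M < card N"
      using v(2)[of M] unfolding maximum_nonedge_matching_def by (meson not_le)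
    moreover from this have "2 * (card V - card N) \<le> 3 * card T"
      using MTP(3) v(1) fin by simp
    moreover have "clique_immersion V E T P"
      using MTP(2) clique_immersion_mono by blast
    ultimately show ?thesis by blast
  next
    case inessential: True
    show ?thesis
    proof (cases "\<exists>M u w. maximum_nonedge_matching V E M \<and> u \<in> V - \<Union>M \<and> w \<in> V - \<Union>M \<and> u \<noteq> w")
      case True
      then obtain M\<^sub>0 u w where M\<^sub>0: "maximum_nonedge_matching V E M\<^sub>0" "u \<in> V - \<Union>M\<^sub>0" "w \<in> V - \<Union>M\<^sub>0" "u \<noteq> w"
        by blast
      \<comment> \<open>\<open>D\<close> consists of the vertices that some maximum matching misses
        together with \<open>u\<close>. Both \<open>C\<close> and \<open>D\<close> are proper
        subsets of \<open>V\<close>, as \<open>u\<close> is in \<open>C\<close> and \<open>w\<close>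
        in \<open>D\<close>; the aim is that the complement has no edge between them.\<close>
      define D where "D = {q \<in> V - {u}. \<exists>M. maximum_nonedge_matching V E M \<and> u \<notin> \<Union>M \<and> q \<notin> \<Union>M}"
      define C where "C = V - D"
      have "u \<in> V" "w \<in> D" "u \<notin> D" "D \<subseteq> V"
        using M\<^sub>0 unfolding D_def by blast+
      then have "D \<subset> V" "C \<subset> V" and un: "V = C \<union> D" and disj: "C \<inter> D = {}"
        unfolding C_def by auto
      have join: "{p, q} \<in> E" if p: "p \<in> C" and q: "q \<in> D" for p q
      proof (cases "p = u")
        case True
        then show ?thesis
          using q maximum_nonedge_matching_missed_edge[OF fin, of E _ u q] p
          unfolding C_def D_def by blast
      next
        case False
        \<comment> \<open>One maximum matching misses \<open>u\<close> and \<open>q\<close>, another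
          misses \<open>p\<close>, so some maximum matching misses \<open>p\<close> along with
          \<open>u\<close> or \<open>q\<close>. The former is excluded because \<open>p\<close> is
          outside \<open>D\<close>, and two vertices missed together are adjacent in
          \<open>G\<close>.\<close>
        obtain M where M: "maximum_nonedge_matching V E M" "u \<in> V - \<Union>M" "q \<in> V - \<Union>M" "u \<noteq> q"
          using q M\<^sub>0 by (auto simp: D_def)
        obtain N where N: "maximum_nonedge_matching V E N" "p \<in> V - \<Union>N"
          using p inessential by (auto simp: C_def)
        have "p \<noteq> q"
          using p q disj by blast
        then obtain L where L: "maximum_nonedge_matching V E L" "p \<in> V - \<Union>L"
          "u \<in> V - \<Union>L \<or> q \<in> V - \<Union>L"
          using maximum_nonedge_matching_missed_trans[OF fin M N False] by blast
        have "u \<notin> V - \<Union>L"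
          using L p False by (auto simp: C_def D_def)
        then show ?thesis
          using maximum_nonedge_matching_missed_edge[OF fin L(1)] L \<open>p \<noteq> q\<close> by blast
      qed
      obtain M\<^sub>1 T\<^sub>1 P\<^sub>1 where 1: "nonedge_matching C E M\<^sub>1" "clique_immersion C E T\<^sub>1 P\<^sub>1"
        "2 * (card C - card M\<^sub>1) \<le> 3 * card T\<^sub>1"
        using IH[OF \<open>C \<subset> V\<close>] by blast
      obtain M\<^sub>2 T\<^sub>2 P\<^sub>2 where 2: "nonedge_matching D E M\<^sub>2" "clique_immersion D E T\<^sub>2 P\<^sub>2"
        "2 * (card D - card M\<^sub>2) \<le> 3 * card T\<^sub>2"
        using IH[OF \<open>D \<subset> V\<close>] by blast
      obtain P where P: "clique_immersion V E (T\<^sub>1 \<union> T\<^sub>2) P"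
        using clique_immersion_join[OF 1(2) 2(2) disj join] un by metis
      have finCD: "finite C" "finite D"
        using fin un by (metis finite_Un)+
      have MU: "\<Union>M\<^sub>1 \<subseteq> C" "\<Union>M\<^sub>2 \<subseteq> D"
        by (fact nonedge_matching_Union_subset[OF 1(1)] nonedge_matching_Union_subset[OF 2(1)])+
      have M: "nonedge_matching V E (M\<^sub>1 \<union> M\<^sub>2)"
      proof -
        have "nonedge_matching V E M\<^sub>1" "nonedge_matching V E M\<^sub>2"
          using 1 2 un nonedge_matching_mono by blast+
        moreover have "disjnt d e" if "d \<in> M\<^sub>1" "e \<in> M\<^sub>2" for d e
          using that MU disj by (auto simp: disjnt_def)
        ultimately show ?thesis
          by (auto simp: nonedge_matching_def pairwise_def disjnt_sym)
      qed
      have "{} \<notin> M\<^sub>1"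
        using 1 by (auto simp: nonedge_matching_def nsets_def)
      moreover have "e = {}" if "e \<in> M\<^sub>1" "e \<in> M\<^sub>2" for e
      proof -
        have "e \<subseteq> C" "e \<subseteq> D"
          using that MU by auto
        then show ?thesis
          using disj by blast
      qed
      ultimately have "M\<^sub>1 \<inter> M\<^sub>2 = {}"
        by blast
      then have "card (M\<^sub>1 \<union> M\<^sub>2) = card M\<^sub>1 + card M\<^sub>2"
        using 1 2 finCD nonedge_matching_finite by (metis card_Un_disjoint)
      moreover have "card V = card C + card D"
        using finCD disj un by (metis card_Un_disjoint)
      moreover have "card (T\<^sub>1 \<union> T\<^sub>2) = card T\<^sub>1 + card T\<^sub>2"
      proof (rule card_Un_disjoint)
        have "T\<^sub>1 \<subseteq> C" "T\<^sub>2 \<subseteq> D"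
          using 1 2 by (auto simp: clique_immersion_def)
        then show "finite T\<^sub>1" "finite T\<^sub>2" "T\<^sub>1 \<inter> T\<^sub>2 = {}"
          using finCD disj finite_subset by blast+
      qed
      ultimately have "2 * (card V - card (M\<^sub>1 \<union> M\<^sub>2)) \<le> 3 * card (T\<^sub>1 \<union> T\<^sub>2)"
        using 1(3) 2(3) by linarith
      then show ?thesis using M P by blast
    next
      case False
      obtain M where M: "maximum_nonedge_matching V E M"
        using ex_maximum_nonedge_matching[OF fin] by blast
      then have mM: "nonedge_matching V E M"
        by (simp add: maximum_nonedge_matching_def)
      show ?thesis
      proof (cases "V = {}")
        case True
        then show ?thesis using mM by (intro exI[of _ M] exI[of _ "{}"]) auto
      next
        case nonempty: False
        obtain T P where TP: "clique_immersion V E T P" "card V + 1 \<le> 3 * card T"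
          using large_clique_immersion[OF fin nonempty alpha] by blast
        \<comment> \<open>A maximum matching misses at most one vertex here, so
          \<open>2 * (card V - card M)\<close> is at most \<open>card V + 1\<close>, the quantity
          controlled by \<open>large_clique_immersion\<close>.\<close>
        have "card (V - \<Union>M) \<le> 1"
          using False M fin by (subst card_le_Suc0_iff_eq[unfolded One_nat_def[symmetric]]) blast+
        moreover have "card (V - \<Union>M) = card V - 2 * card M"
          using nonedge_matching_Union_subset[OF mM] card_Union_nonedge_matching[OF mM] fin
          by (simp add: card_Diff_subset finite_subset)
        ultimately have "2 * (card V - card M) \<le> 3 * card T"
          using TP(2) by linarith
        then show ?thesis using mM TP(1) by blast
      qed
    qed
  qed
qed

text \<open>The colour classes are the pairs of \<open>M\<close> and the single remaining vertices.
  The induction splits off one pair and gives it a fresh colour. As \<open>V\<close> shrinks while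
  \<open>E\<close> stays, the absence of loops in \<open>E\<close> is expressed over a separate set
  \<open>U\<close>.\<close>

lemma ex_proper_colouring_nonedge_matching:
  assumes "finite M" "finite V" "E \<subseteq> nsets U 2" "nonedge_matching V E M"
  shows "\<exists>c. proper_colouring V E (card V - card M) c"
  using assms
proof (induction M arbitrary: V rule: finite_induct)
  case empty
  obtain c where c: "bij_betw c V {0..<card V}"
    using ex_bij_betw_finite_nat[OF \<open>finite V\<close>] by blast
  have "u \<noteq> v" if "{u, v} \<in> E" for u v
    using that empty.prems(2) doubleton_in_nsets_2[of u v U] by blast
  then have "proper_colouring V E (card V) c"
    unfolding proper_colouring_def using c
    by (auto simp: bij_betw_def dest: inj_onD)
  then show ?case by auto
next
  case (insert e M)
  have e: "e \<in> nsets V 2" "e \<notin> E"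
    using insert.prems by (auto simp: nonedge_matching_def)
  then obtain x y where xy: "e = {x, y}" "x \<in> V" "y \<in> V" "x \<noteq> y"
    by (auto elim: nsets2_E)
  have "nonedge_matching (V - e) E M"
  proof -
    have M: "nonedge_matching V E M"
      by (rule nonedge_matching_subset[OF insert.prems(3) subset_insertI])
    have "d \<in> nsets (V - e) 2" if "d \<in> M" for d
    proof -
      have "d \<noteq> e"
        using that insert.hyps by blast
      then have "disjnt d e"
        using that insert.prems(3) by (simp add: nonedge_matching_def pairwise_def)
      moreover have "d \<in> nsets V 2"
        using that M by (auto simp: nonedge_matching_def)
      ultimately show ?thesis
        unfolding nsets_def disjnt_def by blast
    qed
    then show ?thesis
      using M by (auto simp: nonedge_matching_def)
  qed
  then obtain c where c: "proper_colouring (V - e) E (card (V - e) - card M) c"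
    using insert.IH[OF finite_Diff[OF insert.prems(1)] insert.prems(2)] by blast
  define k where "k = card (V - e) - card M"
  \<comment> \<open>The matching fits into \<open>V\<close>, so the truncated subtractions in the
    number of colours are exact.\<close>
  have card: "card V - card (insert e M) = Suc k"
  proof -
    have "card (\<Union>(insert e M)) \<le> card V"
      using nonedge_matching_Union_subset[OF insert.prems(3)] insert.prems by (intro card_mono) auto
    then have "2 * card (insert e M) \<le> card V"
      using card_Union_nonedge_matching[OF insert.prems(3)] by simp
    moreover have "card (V - e) = card V - 2"
      using xy insert.prems by (simp add: card_Diff_subset)
    ultimately show ?thesis
      using insert.hyps by (simp add: k_def)
  qed
  have ne: "u \<noteq> v" if "{u, v} \<in> E" for u v
    using that insert.prems(2) doubleton_in_nsets_2[of u v U] by blast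
  have "proper_colouring V E (Suc k) (\<lambda>v. if v \<in> e then k else c v)"
    unfolding proper_colouring_def
  proof (intro conjI ballI impI)
    fix v assume "v \<in> V"
    then show "(if v \<in> e then k else c v) < Suc k"
      using c by (simp add: proper_colouring_def k_def less_Suc_eq)
  next
    fix u v assume uv: "u \<in> V" "v \<in> V" "{u, v} \<in> E"
    have not_both: "\<not> (u \<in> e \<and> v \<in> e)"
    proof
      assume "u \<in> e \<and> v \<in> e"
      then have "{u, v} = e"
        using ne[OF uv(3)] xy(1) by auto
      then show False
        using uv(3) e(2) by simp
    qed
    have "c z < k" if "z \<notin> e" "z \<in> V" for z
      using c that by (simp add: proper_colouring_def k_def)
    then have not_k: "c z \<noteq> k" if "z \<notin> e" "z \<in> V" for z
      using that by (metis nat_less_le)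
    moreover have "c u \<noteq> c v" if "u \<notin> e" "v \<notin> e"
      using c that uv by (simp add: proper_colouring_def)
    ultimately show "(if u \<in> e then k else c u) \<noteq> (if v \<in> e then k else c v)"
      using uv(1,2) not_both by (cases "u \<in> e"; cases "v \<in> e") (auto simp: not_k not_k[symmetric])
  qed
  then show ?case
    unfolding card by blast
qed

section \<open>The bound on the chromatic number\<close>

theorem theorem1:
  fixes t :: nat and V :: "'a set" and E :: "'a set set"
  assumes "t > 0"
    and "simple_graph V E"
    and "independence_number V E \<le> 2"
    and "\<not> has_strong_odd_complete_immersion t V E"
  shows "int (chromatic_number V E) \<le> \<lceil>3 / 2 * (real t - 1)\<rceil>"
proof -
  have fin: "finite V" and E: "E \<subseteq> nsets V 2"
    using assms(2) by (auto simp: simple_graph_def)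
  have "finite (card ` {S. S \<subseteq> V \<and> indep S E})"
    using fin by simp
  then have "card S \<le> independence_number V E" if "S \<subseteq> V" "indep S E" for S
    unfolding independence_number_def by (rule Max_ge) (use that in blast)
  then have alpha: "\<forall>S\<subseteq>V. indep S E \<longrightarrow> card S \<le> 2"
    using assms(3) by (meson order_trans)
  obtain M T P where M: "nonedge_matching V E M" and T: "clique_immersion V E T P"
    and le: "2 * (card V - card M) \<le> 3 * card T"
    using ex_nonedge_matching_clique_immersion[OF fin alpha] by blast
  have "card T < t"
    using clique_immersion_imp_has_strong_odd_complete_immersion[OF fin T] assms(4) not_le by blast
  have "chromatic_number V E \<le> card V - card M"
    using ex_proper_colouring_nonedge_matching[OF nonedge_matching_finite[OF fin M] fin E M]
    unfolding chromatic_number_def by (rule Least_le)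
  \<comment> \<open>With at most \<open>t - 1\<close> terminals, twice the chromatic number is at
    most \<open>3 * (t - 1)\<close>; the form with \<open>+ 3\<close> avoids subtraction on natural
    numbers.\<close>
  then have "2 * chromatic_number V E + 3 \<le> 3 * t"
    using le \<open>card T < t\<close> by linarith
  then have "real (2 * chromatic_number V E + 3) \<le> real (3 * t)"
    by (rule of_nat_mono)
  then have "real (chromatic_number V E) \<le> 3 / 2 * (real t - 1)"
    by simp
  then have "\<lceil>real (chromatic_number V E)\<rceil> \<le> \<lceil>3 / 2 * (real t - 1)\<rceil>"
    by (rule ceiling_mono)
  then show ?thesis
    by simp
qed

end
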